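(* Let $H \in \mathbb{R}^{n\times n}$ be symmetric positive definite, let $c \in \mathbb{R}^n$, and let $q(x) = \frac12 x^T H x + c^T x$. Given $x_0\in\mathbb{R}^n$, let $x_k$, $k=1,2,\dots$, be the minimizer of $q(x)$ subject to $x\in x_0+\operatorname{span}(\{g_0,\dots,g_{k-1}\})$, where $g_i=\nabla q(x_i)$, and let $r$ be the smallest nonnegative integer with $g_r=0$. Let $0\le k<r$, and let $p_k\in\mathbb{R}^n$ and $\theta_k\in\mathbb{R}$ be such that $x_{k+1}=x_k+\theta_k p_k$. Then $\theta_k\ne 0$, $p_k\neq 0$, and there is a constant $c_k\in\mathbb{R}$ such that $$p_k^T g_i = c_k,\quad i=0,\dots,k,$$ and $$p_k = c_k\sum_{i=0}^k \frac{1}{g_i^T g_i}\, g_i,$$ and moreover $$\theta_k = -\frac{g_k^T p_k}{p_k^T H p_k}.$$ In particular, if the scaling is such that $c_k=-g_k^Tg_k$, then $p_k = p_k^{CG}$, where $p_k^{CG}$ is the search direction of the method of conjugate gradients.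
   Context: The minimizers $x_k$ exist and are unique, and an index $r\le n$ with $g_r=0$ exists. The conjugate gradient search directions are defined, for $0\le k<r$, by the recursion $$p_0^{CG} = -g_0,\qquad p_k^{CG} = -g_k + \frac{g_k^Tg_k}{g_{k-1}^Tg_{k-1}}\,p_{k-1}^{CG}\quad (1\le k<r).$$ Here $\operatorname{span}$ denotes the linear span and $\nabla q(x)=Hx+c$. *)

theory Defs
  imports "HOL-Analysis.Analysis"
begin

definition sym_pos_def :: "real^'n^'n \<Rightarrow> bool" where
  "sym_pos_def H \<longleftrightarrow> transpose H = H \<and> (\<forall>v. v \<noteq> 0 \<longrightarrow> v \<bullet> (H *v v) > 0)"

definition quad :: "real^'n^'n \<Rightarrow> real^'n \<Rightarrow> real^'n \<Rightarrow> real" where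
  "quad H c x = 1/2 * (x \<bullet> (H *v x)) + c \<bullet> x"

(* Only meaningful where f is differentiable. *)
definition grad :: "('a::real_inner \<Rightarrow> real) \<Rightarrow> 'a \<Rightarrow> 'a" where
  "grad f x = (THE D. GDERIV f x :> D)"

(* With g i the gradient at the i-th iterate, the i-th conjugate gradient direction;
   it is only meaningful as long as g 0, ..., g (i - 1) are nonzero. *)
primrec cg_dir :: "(nat \<Rightarrow> 'a::real_inner) \<Rightarrow> nat \<Rightarrow> 'a" where
  "cg_dir g 0 = - g 0"
| "cg_dir g (Suc k) =
     - g (Suc k) + ((g (Suc k) \<bullet> g (Suc k)) / (g k \<bullet> g k)) *\<^sub>R cg_dir g k"

lemma grad_eqI:
  assumes "GDERIV f x :> D"
  shows "grad f x = D"
  unfolding grad_def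
proof (rule the_equality)
  fix E assume "GDERIV f x :> E"
  with assms have "(\<lambda>h. inner h E) = (\<lambda>h. inner h D)"
    unfolding gderiv_def by (blast intro: has_derivative_unique)
  then have "inner (E - D) E = inner (E - D) D"
    by metis
  then have "inner (E - D) (E - D) = 0"
    by (simp add: inner_diff_right)
  then show "E = D" by simp
qed (rule assms)

lemma grad_quad:
  assumes "transpose H = H"
  shows "grad (quad H c) x = H *v x + c"
proof (rule grad_eqI)
  have sym: "x \<bullet> (H *v h) = h \<bullet> (H *v x)" for h
    using assms by (metis dot_lmul_matrix inner_commute vector_transpose_matrix)
  show "GDERIV (quad H c) x :> H *v x + c"
    unfolding gderiv_def quad_def
    by (rule has_derivative_eq_rhs, (rule derivative_intros
          bounded_linear.has_derivative[OF matrix_vector_mul_bounded_linear])+)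
      (auto simp: sym inner_add_right inner_commute[of c] fun_eq_iff)
qed

end

theory Submission
  imports Defs
begin

text \<open>
  Each iterate minimizes \<open>q\<close> over an affine space whose direction space \<open>V j\<close> is spanned by the earlier
  gradients, so \<open>g j\<close> is orthogonal to \<open>V j\<close>; in particular the gradients are mutually orthogonal.
  The step \<open>s = x (k + 1) - x k\<close> lies in \<open>V (k + 1)\<close> and is therefore the sum of its orthogonal
  projections \<open>((s \<bullet> g i) / (g i \<bullet> g i)) g i\<close> with \<open>i \<le> k\<close>. The decisive point is that the numerators
  do not depend on \<open>i\<close>: by symmetry of \<open>H\<close>,
  \<open>s \<bullet> (g (i + 1) - g i) = s \<bullet> H (x (i + 1) - x i) = (g (k + 1) - g k) \<bullet> (x (i + 1) - x i)\<close>,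
  and for \<open>i < k\<close> this vanishes, because \<open>x (i + 1) - x i\<close> lies in \<open>V (i + 1)\<close> and both gradients
  \<open>g k\<close> and \<open>g (k + 1)\<close> are orthogonal to that space.

  The step is nonzero since otherwise \<open>g (k + 1) = g k\<close> would be orthogonal to itself, so dividing by
  the step length transfers everything to \<open>p\<close>. The formula for the step length says that the
  directional derivative along \<open>p\<close> vanishes at \<open>x (k + 1)\<close>, and the conjugate gradient recursion
  unrolls to the same weighted sum of gradients, with the factor \<open>- (g k \<bullet> g k)\<close>.
\<close>

lemma sym_pos_def_inner_commute:
  assumes "sym_pos_def H"
  shows "u \<bullet> (H *v v) = (H *v u) \<bullet> v"
  using assms unfolding sym_pos_def_def
  by (metis dot_lmul_matrix vector_transpose_matrix)

lemma quad_add: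
  assumes "sym_pos_def H"
  shows "quad H c (y + t *\<^sub>R v) =
    quad H c y + t * ((H *v y + c) \<bullet> v) + t\<^sup>2 / 2 * (v \<bullet> (H *v v))"
proof -
  have "v \<bullet> (H *v y) = (H *v y) \<bullet> v" "y \<bullet> (H *v v) = (H *v y) \<bullet> v"
    using sym_pos_def_inner_commute[OF assms] by (simp_all add: inner_commute)
  then show ?thesis
    unfolding quad_def
    by (simp add: matrix_vector_right_distrib matrix_vector_mult_scaleR inner_add_left
        inner_add_right field_simps power2_eq_square)
qed

text \<open>
  Along a line the quadratic \<open>a t + b t\<^sup>2 / 2\<close> with \<open>b > 0\<close> takes the value \<open>- a\<^sup>2 / (2 b)\<close> at
  \<open>t = - a / b\<close>, which is negative unless the slope \<open>a\<close> is zero.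
\<close>
lemma line_minimizer_orthogonal:
  assumes H: "sym_pos_def H"
    and min: "\<And>t. quad H c y \<le> quad H c (y + t *\<^sub>R v)"
  shows "grad (quad H c) y \<bullet> v = 0"
proof (cases "v = 0")
  case False
  define a where "a = (H *v y + c) \<bullet> v"
  define b where "b = v \<bullet> (H *v v)"
  have b: "b > 0"
    using H False by (auto simp: sym_pos_def_def b_def)
  have "0 \<le> (- a / b) * a + (- a / b)\<^sup>2 / 2 * b"
    using min[of "- a / b"] unfolding quad_add[OF H] a_def b_def by simp
  also have "\<dots> = - (a\<^sup>2 / (2 * b))"
    using b by (simp add: field_simps power2_eq_square)
  finally have "a\<^sup>2 / (2 * b) \<le> 0" by simp
  with b have "a = 0"
    by (simp add: divide_le_0_iff)
  then show ?thesis
    using H by (simp add: grad_quad sym_pos_def_def a_def)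
qed simp

lemma affine_minimizer_orthogonal:
  assumes H: "sym_pos_def H" and V: "subspace V"
    and min: "is_arg_min (quad H c) (\<lambda>y. y \<in> {a + v | v. v \<in> V}) y"
    and v: "v \<in> V"
  shows "grad (quad H c) y \<bullet> v = 0"
proof (rule line_minimizer_orthogonal[OF H])
  fix t
  obtain u where u: "y = a + u" "u \<in> V"
    using min by (auto simp: is_arg_min_def)
  have "y + t *\<^sub>R v = a + (u + t *\<^sub>R v)" "u + t *\<^sub>R v \<in> V"
    using u v V by (auto simp: subspace_add subspace_scale)
  then have "y + t *\<^sub>R v \<in> {a + v | v. v \<in> V}" by blast
  then show "quad H c y \<le> quad H c (y + t *\<^sub>R v)"
    using min unfolding is_arg_min_def by (meson not_le)
qed

text \<open>
  The difference of both sides lies in the span and is orthogonal to every spanning vector, hence to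
  itself. A zero member of the family contributes nothing on either side, as division by zero
  yields zero.
\<close>
lemma orthogonal_family_expansion:
  fixes f :: "'i \<Rightarrow> 'a::real_inner"
  assumes A: "finite A" and v: "v \<in> span (f ` A)"
    and orth: "\<And>i j. i \<in> A \<Longrightarrow> j \<in> A \<Longrightarrow> i \<noteq> j \<Longrightarrow> f i \<bullet> f j = 0"
  shows "v = (\<Sum>i\<in>A. ((v \<bullet> f i) / (f i \<bullet> f i)) *\<^sub>R f i)"
proof -
  define w where "w = v - (\<Sum>i\<in>A. ((v \<bullet> f i) / (f i \<bullet> f i)) *\<^sub>R f i)"
  have "w \<in> span (f ` A)"
    unfolding w_def by (intro span_diff v span_sum span_scale span_base imageI)
  moreover have "orthogonal w y" if "y \<in> f ` A" for y
  proof -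
    obtain j where j: "j \<in> A" "y = f j" using \<open>y \<in> f ` A\<close> by auto
    have "(\<Sum>i\<in>A. ((v \<bullet> f i) / (f i \<bullet> f i)) *\<^sub>R f i) \<bullet> f j =
        (\<Sum>i\<in>A. if i = j then v \<bullet> f j else 0)"
      unfolding inner_sum_left using orth j by (intro sum.cong) auto
    also have "\<dots> = v \<bullet> f j" using A j by simp
    finally show ?thesis
      by (simp add: orthogonal_def w_def j inner_diff_left)
  qed
  ultimately have "orthogonal w w"
    using orthogonal_to_span by blast
  then show ?thesis by (simp add: orthogonal_def w_def)
qed

lemma cg_dir_eq_sum:
  assumes "\<And>i. i \<le> k \<Longrightarrow> g i \<noteq> 0"
  shows "cg_dir g k = - (g k \<bullet> g k) *\<^sub>R (\<Sum>i\<le>k. (1 / (g i \<bullet> g i)) *\<^sub>R g i)"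
  using assms
proof (induction k)
  case (Suc k)
  have "g k \<noteq> 0" "g (Suc k) \<noteq> 0" using Suc.prems by auto
  moreover have "cg_dir g k = - (g k \<bullet> g k) *\<^sub>R (\<Sum>i\<le>k. (1 / (g i \<bullet> g i)) *\<^sub>R g i)"
    using Suc by auto
  ultimately show ?case
    by (simp add: scaleR_add_right)
qed simp

theorem mainTheorem2:
  fixes H :: "real^'n^'n" and c :: "real^'n" and x g :: "nat \<Rightarrow> real^'n"
    and r k :: nat and p :: "real^'n" and \<theta> :: real
  assumes "sym_pos_def H"
    and "\<And>i. g i = grad (quad H c) (x i)"
    and "\<And>j. j \<ge> 1 \<Longrightarrow>
           is_arg_min (quad H c) (\<lambda>y. y \<in> {x 0 + v | v. v \<in> span (g ` {..<j})}) (x j)"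
    and "r = (LEAST i. g i = 0)"
    and "k < r"
    and "x (Suc k) = x k + \<theta> *\<^sub>R p"
  shows "\<theta> \<noteq> 0 \<and> p \<noteq> 0 \<and>
    (\<exists>ck::real.
       (\<forall>i\<le>k. p \<bullet> g i = ck) \<and>
       p = ck *\<^sub>R (\<Sum>i\<le>k. (1 / (g i \<bullet> g i)) *\<^sub>R g i) \<and>
       \<theta> = - ((g k \<bullet> p) / (p \<bullet> (H *v p))) \<and>
       (ck = - (g k \<bullet> g k) \<longrightarrow> p = cg_dir g k))"
proof -
  note H = assms(1)
  define V where "V j = span (g ` {..<j})" for j
  have g_eq: "g i = H *v x i + c" for i
    using H assms(2) by (simp add: grad_quad sym_pos_def_def)
  have nz: "g i \<noteq> 0" if "i \<le> k" for i
    using that assms(4,5) not_less_Least[of i "\<lambda>i. g i = 0"] by auto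
  have V_mono: "V i \<subseteq> V j" if "i \<le> j" for i j
    unfolding V_def using that by (intro span_mono image_mono) auto
  have g_in_V: "g i \<in> V j" if "i < j" for i j
    unfolding V_def using that by (intro span_base) auto
  have g_orth_V: "g j \<bullet> v = 0" if "v \<in> V j" for j v
  proof (cases "j = 0")
    case True
    then show ?thesis using that by (simp add: V_def)
  next
    case False
    have "grad (quad H c) (x j) \<bullet> v = 0"
      using False that unfolding V_def
      by (intro affine_minimizer_orthogonal[OF H subspace_span assms(3)]) auto
    then show ?thesis by (simp add: assms(2))
  qed
  have g_orth: "g i \<bullet> g j = 0" if "i \<noteq> j" for i j
    using that g_orth_V g_in_V by (metis inner_commute linorder_neqE_nat)
  have x_in: "x j - x 0 \<in> V j" for j
  proof (cases "j = 0")
    case False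
    then show ?thesis using assms(3)[of j] by (auto simp: is_arg_min_def V_def)
  qed (simp add: V_def)
  have step_in: "x (Suc i) - x i \<in> V (Suc i)" for i
  proof -
    have "x (Suc i) - x 0 \<in> V (Suc i)" "x i - x 0 \<in> V (Suc i)"
      using x_in V_mono[of i "Suc i"] by auto
    then have "(x (Suc i) - x 0) - (x i - x 0) \<in> V (Suc i)"
      unfolding V_def by (rule span_diff)
    then show ?thesis by simp
  qed
  have H_step: "H *v (x (Suc i) - x i) = g (Suc i) - g i" for i
    by (simp add: g_eq matrix_vector_mult_diff_distrib)

  define s where "s = x (Suc k) - x k"
  have s_eq: "s = \<theta> *\<^sub>R p" by (simp add: s_def assms(6))
  have s_in: "s \<in> V (Suc k)" unfolding s_def by (rule step_in)
  have g_Suc_s: "g (Suc k) \<bullet> s = 0" using s_in by (rule g_orth_V)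
  have s_next: "s \<bullet> g (Suc i) = s \<bullet> g i" if "i < k" for i
  proof -
    have "s \<bullet> (g (Suc i) - g i) = (H *v s) \<bullet> (x (Suc i) - x i)"
      by (simp only: H_step[symmetric] sym_pos_def_inner_commute[OF H])
    also have "\<dots> = g (Suc k) \<bullet> (x (Suc i) - x i) - g k \<bullet> (x (Suc i) - x i)"
      unfolding s_def H_step by (rule inner_diff_left)
    also have "\<dots> = 0"
      using that step_in[of i] V_mono[of "Suc i" k] V_mono[of "Suc i" "Suc k"]
      by (subst (1 2) g_orth_V) auto
    finally show ?thesis by (simp add: inner_diff_right)
  qed
  have s_const: "s \<bullet> g i = s \<bullet> g k" if "i \<le> k" for i
    using that by (induction rule: inc_induct) (auto simp: s_next)

  have "s \<noteq> 0"
  proof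
    assume "s = 0"
    then have "g (Suc k) = g k" by (simp add: s_def g_eq)
    then show False using g_orth[of "Suc k" k] nz[of k] by simp
  qed
  then have \<theta>: "\<theta> \<noteq> 0" and p: "p \<noteq> 0" by (auto simp: s_eq)

  define ck where "ck = p \<bullet> g k"
  have p_const: "p \<bullet> g i = ck" if "i \<le> k" for i
    using s_const[OF that] \<theta> by (simp add: s_eq ck_def)
  have "p = (1 / \<theta>) *\<^sub>R s" using \<theta> by (simp add: s_eq)
  then have "p \<in> span (g ` {..k})"
    using s_in by (simp add: V_def lessThan_Suc_atMost span_scale)
  then have "p = (\<Sum>i\<le>k. ((p \<bullet> g i) / (g i \<bullet> g i)) *\<^sub>R g i)"
    by (intro orthogonal_family_expansion) (auto simp: g_orth)
  also have "\<dots> = ck *\<^sub>R (\<Sum>i\<le>k. (1 / (g i \<bullet> g i)) *\<^sub>R g i)"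
    unfolding scaleR_sum_right by (intro sum.cong) (auto simp: p_const)
  finally have p_sum: "p = ck *\<^sub>R (\<Sum>i\<le>k. (1 / (g i \<bullet> g i)) *\<^sub>R g i)" .

  have "p \<bullet> (H *v p) > 0" using H p by (simp add: sym_pos_def_def)
  moreover have "\<theta> * (p \<bullet> (H *v p)) = - (g k \<bullet> p)"
  proof -
    have "\<theta> * (p \<bullet> (H *v p)) = p \<bullet> (H *v s)"
      by (simp add: s_eq matrix_vector_mult_scaleR)
    also have "\<dots> = p \<bullet> g (Suc k) - p \<bullet> g k"
      by (simp add: s_def H_step inner_diff_right)
    finally show ?thesis
      using g_Suc_s \<theta> by (simp add: s_eq inner_commute)
  qed
  ultimately have \<theta>_eq: "\<theta> = - ((g k \<bullet> p) / (p \<bullet> (H *v p)))"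
    by (simp add: field_simps)

  have "p = cg_dir g k" if "ck = - (g k \<bullet> g k)"
    using p_sum cg_dir_eq_sum[of k g] nz that by simp
  with \<theta> p p_const p_sum \<theta>_eq show ?thesis by blast
qed

end
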